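(* For any $\delta>0$, there is no randomized mechanism in the Euclidean plane that is truthful in expectation, $1$-consistent, and $(2-\delta)$-robust, even for two-agent instances and even if it is provided with full predictions $\hat{\mathbf{x}}$ (a predicted location for each agent). This is tight: there exists a randomized mechanism for two-agent instances in the plane, provided with such predictions, that is truthful in expectation, $1$-consistent, and $2$-robust.
   Context: Facility location in the plane. There are $n$ agents (two-agent instances: $n=2$) with location profile $\mathbf{x}=\langle x_1,\dots,x_n\rangle\in(\mathbb{R}^2)^n$; $d$ is the Euclidean distance. A full prediction is $\hat{\mathbf{x}}=\langle\hat x_1,\dots,\hat x_n\rangle\in(\mathbb{R}^2)^n$; it is accurate for $\mathbf{x}$ if $\hat{\mathbf{x}}=\mathbf{x}$. A randomized mechanism $f$ assigns to every profile $\mathbf{x}$ and every prediction $\hat{\mathbf{x}}$ a random facility location $f(\mathbf{x},\hat{\mathbf{x}})$, i.e. a Borel probability distribution on $\mathbb{R}^2$ (a deterministic mechanism is a special case). Standing assumptions on mechanisms: unanimous (if all $x_i$ equal a common point $p$, the facility is at $p$); anonymous (for a fixed prediction, the outcome distribution is unchanged when the reported locations are permuted among the agents); scale-independent (multiplying all coordinates of reported and predicted locations by the same $\lambda>0$ multiplies the random facility location by $\lambda$). Truthful in expectation: for every $\hat{\mathbf{x}}$, every $\mathbf{x}$, every agent $i$ and every $x_i'\in\mathbb{R}^2$, $\mathbb{E}[d(x_i,f(\mathbf{x},\hat{\mathbf{x}}))]\le\mathbb{E}[d(x_i,f((\mathbf{x}_{-i},x_i'),\hat{\mathbf{x}}))]$,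 where $(\mathbf{x}_{-i},x_i')$ is $\mathbf{x}$ with $x_i$ replaced by $x_i'$. Egalitarian social cost: $C(f(\mathbf{x},\hat{\mathbf{x}}),\mathbf{x})=\mathbb{E}[\max_i d(x_i,f(\mathbf{x},\hat{\mathbf{x}}))]$; $o(\mathbf{x})$ is the minimizer of $\max_i d(x_i,y)$ over $y\in\mathbb{R}^2$, with optimal cost $C(o(\mathbf{x}),\mathbf{x})$. The mechanism is $\alpha$-consistent if $C(f(\mathbf{x},\hat{\mathbf{x}}),\mathbf{x})\le\alpha\,C(o(\mathbf{x}),\mathbf{x})$ for all $\mathbf{x}$ and all $\hat{\mathbf{x}}$ accurate for $\mathbf{x}$; it is $\beta$-robust if $C(f(\mathbf{x},\hat{\mathbf{x}}),\mathbf{x})\le\beta\,C(o(\mathbf{x}),\mathbf{x})$ for all $\mathbf{x}$ and all $\hat{\mathbf{x}}$. *)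

theory Defs
  imports "HOL-Probability.Probability"
begin

type_synonym point = "real ^ 2"
type_synonym 'n profile = "'n \<Rightarrow> point"

text \<open>A randomized mechanism for agents indexed by the finite type \<open>'n\<close> maps the reported
  profile and the full prediction to the law of the facility location.\<close>

type_synonym 'n mechanism = "'n profile \<Rightarrow> 'n profile \<Rightarrow> point measure"

definition unanimous :: "'n::finite mechanism \<Rightarrow> bool" where
  "unanimous f \<longleftrightarrow> (\<forall>p xh. f (\<lambda>_. p) xh = return borel p)"

definition anonymous :: "'n::finite mechanism \<Rightarrow> bool" where
  "anonymous f \<longleftrightarrow> (\<forall>\<pi> x xh. bij \<pi> \<longrightarrow> f (x \<circ> \<pi>) xh = f x xh)"

definition scale_independent :: "'n::finite mechanism \<Rightarrow> bool" where
  "scale_independent f \<longleftrightarrow>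
     (\<forall>c>0. \<forall>x xh. f (\<lambda>i. c *\<^sub>R x i) (\<lambda>i. c *\<^sub>R xh i) = distr (f x xh) borel (\<lambda>y. c *\<^sub>R y))"

definition randomized_mechanism :: "'n::finite mechanism \<Rightarrow> bool" where
  "randomized_mechanism f \<longleftrightarrow>
     (\<forall>x xh. prob_space (f x xh) \<and> sets (f x xh) = sets borel) \<and>
     unanimous f \<and> anonymous f \<and> scale_independent f"

text \<open>Expectations of (nonnegative) distances are taken in \<open>ennreal\<close>: no moment condition is
  imposed on the facility location, and the Bochner integral would assign the value \<open>0\<close> to a
  distance of infinite expectation.\<close>

definition expected_dist :: "point \<Rightarrow> point measure \<Rightarrow> ennreal" where
  "expected_dist p \<mu> = (\<integral>\<^sup>+ y. ennreal (dist p y) \<partial>\<mu>)"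

definition truthful_in_expectation :: "'n::finite mechanism \<Rightarrow> bool" where
  "truthful_in_expectation f \<longleftrightarrow>
     (\<forall>xh x i x'. expected_dist (x i) (f x xh) \<le> expected_dist (x i) (f (x(i := x')) xh))"

definition max_dist :: "'n::finite profile \<Rightarrow> point \<Rightarrow> real" where
  "max_dist x y = (MAX i. dist (x i) y)"

definition egalitarian_cost :: "point measure \<Rightarrow> 'n::finite profile \<Rightarrow> ennreal" where
  "egalitarian_cost \<mu> x = (\<integral>\<^sup>+ y. ennreal (max_dist x y) \<partial>\<mu>)"

definition opt_location :: "'n::finite profile \<Rightarrow> point" where
  "opt_location x = arg_min (max_dist x) (\<lambda>_. True)"

definition opt_cost :: "'n::finite profile \<Rightarrow> real" where
  "opt_cost x = max_dist x (opt_location x)"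

definition consistent :: "real \<Rightarrow> 'n::finite mechanism \<Rightarrow> bool" where
  "consistent \<alpha> f \<longleftrightarrow>
     (\<forall>x xh. xh = x \<longrightarrow> egalitarian_cost (f x xh) x \<le> ennreal (\<alpha> * opt_cost x))"

text \<open>For \<open>\<beta> < 0\<close> the embedding \<open>ennreal\<close> truncates the bound to \<open>0\<close>. This only makes the property
  easier to satisfy, hence its impossibility stronger.\<close>

definition robust :: "real \<Rightarrow> 'n::finite mechanism \<Rightarrow> bool" where
  "robust \<beta> f \<longleftrightarrow>
     (\<forall>x xh. egalitarian_cost (f x xh) x \<le> ennreal (\<beta> * opt_cost x))"

text \<open>The minimum defining \<^const>\<open>opt_location\<close> is attained, so \<^const>\<open>arg_min\<close> picks a minimizer.\<close>

lemma max_dist_ge: "dist (x i) y \<le> max_dist x y"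
  unfolding max_dist_def by (intro Max_ge) auto

lemma max_dist_le_iff: "max_dist x y \<le> r \<longleftrightarrow> (\<forall>i. dist (x i) y \<le> r)"
  unfolding max_dist_def by (subst Max_le_iff) auto

lemma max_dist_lipschitz: "\<bar>max_dist x y - max_dist x z\<bar> \<le> dist y z"
proof -
  have "max_dist x y \<le> max_dist x z + dist y z" for y z
    unfolding max_dist_le_iff
    by (metis add.commute add_left_mono dist_commute dist_triangle max_dist_ge order_trans)
  from this[of y z] this[of z y] show ?thesis
    by (simp add: dist_commute abs_le_iff)
qed

lemma continuous_on_max_dist: "continuous_on A (max_dist x)"
  unfolding continuous_on_iff
proof (intro ballI allI impI)
  fix a and e :: real assume "0 < e"
  then show "\<exists>d>0. \<forall>b\<in>A. dist b a < d \<longrightarrow> dist (max_dist x b) (max_dist x a) < e"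
    by (metis dist_real_def le_less_trans max_dist_lipschitz)
qed

lemma opt_location_minimizes: "max_dist x (opt_location x) \<le> max_dist x y"
proof -
  fix i0
  define B where "B = cball (x i0) (max_dist x (x i0))"
  have "x i0 \<in> B"
    using max_dist_ge[of x i0 "x i0"] by (simp add: B_def)
  moreover have "compact B" by (simp add: B_def)
  ultimately obtain m where m: "m \<in> B" "\<And>z. z \<in> B \<Longrightarrow> max_dist x m \<le> max_dist x z"
    using continuous_attains_inf[of B "max_dist x"] continuous_on_max_dist by blast
  have "max_dist x m \<le> max_dist x z" for z
  proof (cases "z \<in> B")
    case False
    have "max_dist x m \<le> max_dist x (x i0)" using m(2) \<open>x i0 \<in> B\<close> .
    also have "\<dots> \<le> dist (x i0) z" using False by (simp add: B_def)
    also have "\<dots> \<le> max_dist x z" by (rule max_dist_ge)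
    finally show ?thesis .
  qed (use m in auto)
  then have "is_arg_min (max_dist x) (\<lambda>_. True) m"
    by (simp add: is_arg_min_linorder)
  then have "is_arg_min (max_dist x) (\<lambda>_. True) (opt_location x)"
    unfolding opt_location_def arg_min_def by (rule someI)
  then show ?thesis by (simp add: is_arg_min_linorder)
qed

end

(* Impossibility: predict one agent at a and all others at -a.  When the prediction is accurate,
   1-consistency forces the facility onto the midpoint 0.  If the first agent is really at 0, it
   can report a and obtain the facility at its own location; so by truthfulness the facility is at
   0 as well, which is twice the optimal cost for the profile in which all others are at -a.

   Tightness: take the coordinatewise median of the two reports and the predicted midpoint.  It
   lies in the rectangle with diagonal x1 x2, hence within distance d(x1, x2), twice the optimal
   cost, of both agents. *)
theory Submission imports Defs begin

lemma opt_cost_le: "opt_cost x \<le> max_dist x y"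
  unfolding opt_cost_def by (rule opt_location_minimizes)

lemma max_dist_nonneg: "0 \<le> max_dist x y"
  \<comment> \<open>\<open>undefined\<close> stands for an arbitrary agent; the index type is
    nonempty.\<close>
  using max_dist_ge[of x undefined y] zero_le_dist order_trans by blast

lemma borel_measurable_max_dist [measurable]: "max_dist x \<in> borel_measurable borel"
  using continuous_on_max_dist by (rule borel_measurable_continuous_onI)

lemma expected_dist_return: "expected_dist p (return borel q) = ennreal (dist p q)"
  unfolding expected_dist_def by (subst nn_integral_return) auto

lemma egalitarian_cost_return: "egalitarian_cost (return borel q) x = ennreal (max_dist x q)"
  unfolding egalitarian_cost_def by (subst nn_integral_return) auto

text \<open>Translates between expected distances, in which truthfulness is stated, and almost sure
  locations, which determine the cost.\<close>

lemma expected_dist_eq_0_iff: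
  assumes [measurable_cong]: "sets \<mu> = sets borel"
  shows "expected_dist p \<mu> = 0 \<longleftrightarrow> (AE y in \<mu>. y = p)"
  unfolding expected_dist_def by (subst nn_integral_0_iff_AE) (auto simp: ennreal_eq_0_iff)

lemma egalitarian_cost_of_AE_eq:
  assumes "prob_space \<mu>" "AE y in \<mu>. y = p"
  shows "egalitarian_cost \<mu> x = ennreal (max_dist x p)"
proof -
  interpret prob_space \<mu> by fact
  have "egalitarian_cost \<mu> x = (\<integral>\<^sup>+ y. ennreal (max_dist x p) \<partial>\<mu>)"
    unfolding egalitarian_cost_def using assms(2) by (intro nn_integral_cong_AE) auto
  then show ?thesis by (simp add: emeasure_space_1)
qed

text \<open>Since \<mu> has mass 1, the cost is \<open>max_dist x p\<close> plus the integral of a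
  nonnegative excess. The bound forces this integral to be 0, so the excess vanishes almost
  everywhere, which happens only at \<open>p\<close>.\<close>

lemma AE_eq_of_egalitarian_cost_le:
  assumes "prob_space \<mu>" and [measurable_cong]: "sets \<mu> = sets borel"
    and le: "egalitarian_cost \<mu> x \<le> ennreal (max_dist x p)"
    and unique: "\<And>y. y \<noteq> p \<Longrightarrow> max_dist x p < max_dist x y"
  shows "AE y in \<mu>. y = p"
proof -
  interpret prob_space \<mu> by fact
  let ?excess = "\<lambda>y. ennreal (max_dist x y - max_dist x p)"
  have [measurable]: "?excess \<in> borel_measurable \<mu>"
    by measurable
  have min: "max_dist x p \<le> max_dist x y" for y
    using unique[of y] by (cases "y = p") auto
  have "egalitarian_cost \<mu> x = (\<integral>\<^sup>+ y. ennreal (max_dist x p) + ?excess y \<partial>\<mu>)"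
    unfolding egalitarian_cost_def using min max_dist_nonneg[of x p]
    by (intro nn_integral_cong) (simp flip: ennreal_plus)
  also have "\<dots> = ennreal (max_dist x p) + (\<integral>\<^sup>+ y. ?excess y \<partial>\<mu>)"
    by (subst nn_integral_add) (auto simp: emeasure_space_1)
  finally have "ennreal (max_dist x p) + (\<integral>\<^sup>+ y. ?excess y \<partial>\<mu>) \<le> ennreal (max_dist x p) + 0"
    using le by simp
  \<comment> \<open>Cancellation in \<open>ennreal\<close> is sound here because
    \<open>ennreal (max_dist x p)\<close> is finite.\<close>
  then have "(\<integral>\<^sup>+ y. ?excess y \<partial>\<mu>) = 0"
    by (subst (asm) ennreal_add_left_cancel_le) auto
  then have "AE y in \<mu>. ?excess y = 0"
    by (subst (asm) nn_integral_0_iff_AE) auto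
  then show ?thesis
  proof eventually_elim
    case (elim y)
    then show ?case using unique[of y] by (auto simp: ennreal_eq_0_iff)
  qed
qed

text \<open>By the parallelogram law the squared distances from \<open>y\<close> to \<open>p\<close>
  and \<open>- p\<close> sum to twice the sum of the squared norms of \<open>p\<close> and
  \<open>y\<close>, so both distances are at most \<open>norm p\<close> only for
  \<open>y = 0\<close>.\<close>

lemma norm_less_max_dist_antipodal:
  fixes x :: "'n::finite profile"
  assumes "x i = p" "x j = - p" "y \<noteq> 0"
  shows "norm p < max_dist x y"
proof (rule ccontr)
  assume "\<not> norm p < max_dist x y"
  then have "dist p y \<le> norm p" "dist (- p) y \<le> norm p"
    using max_dist_ge[of x i y] max_dist_ge[of x j y] assms by auto
  then have "(norm (p - y))\<^sup>2 \<le> (norm p)\<^sup>2" "(norm (p + y))\<^sup>2 \<le> (norm p)\<^sup>2"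
    by (auto intro!: power_mono simp: dist_norm norm_minus_commute add.commute)
  then have "y \<bullet> y \<le> 0"
    by (simp add: power2_norm_eq_inner inner_diff_left inner_diff_right inner_add_left
        inner_add_right inner_commute)
  with assms(3) inner_gt_zero_iff[of y] show False by linarith
qed

lemma not_robust_of_truthful_consistent:
  fixes f :: "'n::finite mechanism"
  assumes card: "2 \<le> CARD('n)" and "\<delta> > 0"
    and f: "randomized_mechanism f" "truthful_in_expectation f" "consistent 1 f"
  shows "\<not> robust (2 - \<delta>) f"
proof
  assume robust: "robust (2 - \<delta>) f"
  have prob: "prob_space (f x xh)" and sets: "sets (f x xh) = sets borel" for x xh
    using f(1) by (auto simp: randomized_mechanism_def)
  obtain i j :: 'n where "i \<noteq> j"
    using card card_le_Suc0_iff_eq[of "UNIV :: 'n set"] by auto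
  define a :: point where "a = axis 1 1"
  have [simp]: "norm a = 1" by (simp add: a_def)
  define xh where "xh = (\<lambda>_::'n. - a)(i := a)"
  have [simp]: "xh i = a" "xh j = - a"
    using \<open>i \<noteq> j\<close> by (auto simp: xh_def)
  have "max_dist xh 0 \<le> 1" "dist (xh i) 0 = 1"
    by (auto simp: max_dist_le_iff xh_def)
  then have dist_xh: "max_dist xh 0 = 1"
    using max_dist_ge[of xh i 0] by auto
  have "egalitarian_cost (f xh xh) xh \<le> ennreal (opt_cost xh)"
    using f(3) by (simp add: consistent_def)
  also have "\<dots> \<le> ennreal (max_dist xh 0)"
    by (intro ennreal_leI opt_cost_le)
  finally have "AE y in f xh xh. y = 0"
    by (rule AE_eq_of_egalitarian_cost_le[OF prob sets])
      (use norm_less_max_dist_antipodal[of xh i a j] dist_xh in auto)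
  then have xh_at: "expected_dist 0 (f xh xh) = 0"
    by (simp add: expected_dist_eq_0_iff[OF sets])

  \<comment> \<open>The true profile: agent \<open>i\<close> sits at 0, and its misreport
    \<open>a\<close> recreates the accurately predicted profile \<open>xh\<close>.\<close>
  define x where "x = xh(i := 0)"
  have "expected_dist (x i) (f x xh) \<le> expected_dist (x i) (f (x(i := a)) xh)"
    using f(2) by (auto simp: truthful_in_expectation_def)
  moreover have "x(i := a) = xh" "x i = 0"
    by (auto simp: x_def)
  ultimately have "AE y in f x xh. y = 0"
    using xh_at by (simp add: expected_dist_eq_0_iff[OF sets, symmetric])
  then have "egalitarian_cost (f x xh) x = ennreal (max_dist x 0)"
    by (rule egalitarian_cost_of_AE_eq[OF prob])
  then have "ennreal (max_dist x 0) \<le> ennreal ((2 - \<delta>) * opt_cost x)"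
    using robust by (metis robust_def)
  moreover have "1 \<le> max_dist x 0"
    using max_dist_ge[of x j 0] \<open>i \<noteq> j\<close> by (simp add: x_def)
  \<comment> \<open>\<open>ennreal\<close> truncates negative reals to 0, but the left-hand side is
    at least 1, so the bound holds in the reals, also for \<delta> > 2.\<close>
  ultimately have ge: "1 \<le> (2 - \<delta>) * opt_cost x"
    by (auto simp: ennreal_le_iff2)
  have "max_dist x (midpoint 0 (- a)) \<le> 1 / 2"
    unfolding max_dist_le_iff by (auto simp: x_def xh_def dist_midpoint)
  then have half: "opt_cost x \<le> 1 / 2"
    using opt_cost_le order_trans by blast
  \<comment> \<open>Strict positivity makes the loss \<open>\<delta> * opt_cost x\<close> strict, so
    that \<open>(2 - \<delta>) * opt_cost x\<close> falls below 1.\<close>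
  have "0 < opt_cost x"
    using ge max_dist_nonneg[of x "opt_location x"]
    by (cases "opt_cost x = 0") (auto simp: opt_cost_def)
  then have "0 < \<delta> * opt_cost x"
    using \<open>\<delta> > 0\<close> by simp
  with ge half show False by (simp add: left_diff_distrib)
qed

text \<open>In each coordinate, \<open>m\<close> is clamped to the interval spanned by
  \<open>p\<close> and \<open>q\<close>; this is the median of the three numbers.\<close>

definition coord_median :: "point \<Rightarrow> point \<Rightarrow> point \<Rightarrow> point" where
  "coord_median p q m = (\<chi> k. max (min (p $ k) (q $ k)) (min (max (p $ k) (q $ k)) (m $ k)))"

lemma coord_median_commute: "coord_median p q m = coord_median q p m"
  by (simp add: coord_median_def min.commute max.commute)

lemma coord_median_same: "coord_median p p m = p"
  by (simp add: coord_median_def vec_eq_iff)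

lemma coord_median_midpoint: "coord_median p q (midpoint p q) = midpoint p q"
  by (auto simp: coord_median_def midpoint_def vec_eq_iff min_def max_def)

lemma coord_median_scaleR:
  assumes "c > 0"
  shows "coord_median (c *\<^sub>R p) (c *\<^sub>R q) (c *\<^sub>R m) = c *\<^sub>R coord_median p q m"
  using assms by (auto simp: coord_median_def vec_eq_iff min_def max_def)

text \<open>Carries one-dimensional properties of the median over to the plane, coordinate by
  coordinate.\<close>

lemma dist_vec_mono:
  fixes p q p' q' :: point
  assumes "\<And>k. \<bar>p $ k - q $ k\<bar> \<le> \<bar>p' $ k - q' $ k\<bar>"
  shows "dist p q \<le> dist p' q'"
  unfolding dist_norm by (rule norm_le_componentwise_cart) (use assms in simp)

lemma dist_coord_median_le: "dist p (coord_median p q m) \<le> dist p q"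
  by (rule dist_vec_mono) (auto simp: coord_median_def)

text \<open>In each coordinate the median is the point nearest to \<open>p\<close> in the interval
  between \<open>q\<close> and \<open>m\<close>, and under any report \<open>p'\<close> it stays in
  that interval.\<close>

lemma coord_median_truthful: "dist p (coord_median p q m) \<le> dist p (coord_median p' q m)"
  by (rule dist_vec_mono) (auto simp: coord_median_def min_def max_def)

lemma bij_2_cases:
  fixes \<pi> :: "2 \<Rightarrow> 2"
  assumes "bij \<pi>"
  obtains "\<pi> 1 = 1" "\<pi> 2 = 2" | "\<pi> 1 = 2" "\<pi> 2 = 1"
  using assms exhaust_2 bij_is_inj injD by (metis (full_types) one_neq_zero zero_neq_one)

text \<open>Triangle inequality through the optimal location.\<close>

lemma dist_le_twice_opt_cost: "dist (x i) (x j) \<le> 2 * opt_cost x"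
  using max_dist_ge[of x i "opt_location x"] max_dist_ge[of x j "opt_location x"]
    dist_triangle2[of "x i" "x j" "opt_location x"]
  by (simp add: opt_cost_def)

text \<open>A deterministic rule, encoded as a point mass. An accurate prediction makes the third
  argument the optimal location.\<close>

definition median_mechanism :: "2 mechanism" where
  "median_mechanism x xh = return borel (coord_median (x 1) (x 2) (midpoint (xh 1) (xh 2)))"

lemma randomized_mechanism_median: "randomized_mechanism median_mechanism"
proof -
  have "anonymous median_mechanism"
    unfolding anonymous_def
  proof (intro allI impI)
    fix \<pi> :: "2 \<Rightarrow> 2" and x xh :: "2 profile"
    assume "bij \<pi>"
    then show "median_mechanism (x \<circ> \<pi>) xh = median_mechanism x xh"
      by (cases rule: bij_2_cases) (simp_all add: median_mechanism_def coord_median_commute)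
  qed
  moreover have "scale_independent median_mechanism"
    unfolding scale_independent_def
  proof (intro allI impI)
    fix c :: real and x xh :: "2 profile"
    assume "c > 0"
    moreover have "midpoint (c *\<^sub>R p) (c *\<^sub>R q) = c *\<^sub>R midpoint p q" for p q :: point
      by (simp add: midpoint_def algebra_simps)
    ultimately show "median_mechanism (\<lambda>i. c *\<^sub>R x i) (\<lambda>i. c *\<^sub>R xh i) =
        distr (median_mechanism x xh) borel (\<lambda>y. c *\<^sub>R y)"
      by (simp add: median_mechanism_def distr_return coord_median_scaleR)
  qed
  ultimately show ?thesis
    by (auto simp: randomized_mechanism_def unanimous_def median_mechanism_def
        coord_median_same intro!: prob_space_return)
qed

lemma truthful_median: "truthful_in_expectation median_mechanism"
proof -
  \<comment> \<open>The second agent's case, by symmetry of the median in the two reports.\<close>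
  have "dist q (coord_median p q m) \<le> dist q (coord_median p q' m)" for p q q' m
    using coord_median_truthful coord_median_commute by metis
  then show ?thesis
    by (simp add: truthful_in_expectation_def forall_2 median_mechanism_def
        expected_dist_return coord_median_truthful)
qed

lemma consistent_median: "consistent 1 median_mechanism"
  unfolding consistent_def
proof (intro allI impI)
  fix x xh :: "2 profile"
  assume "xh = x"
  \<comment> \<open>The midpoint is at half the distance \<open>dist (x 1) (x 2)\<close> from both
    agents, and no location has a smaller maximum.\<close>
  have "max_dist x (midpoint (x 1) (x 2)) \<le> opt_cost x"
    using dist_le_twice_opt_cost[of x 1 2]
    by (simp add: max_dist_le_iff forall_2 dist_midpoint)
  then show "egalitarian_cost (median_mechanism x xh) x \<le> ennreal (1 * opt_cost x)"
    using \<open>xh = x\<close>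
    by (simp add: median_mechanism_def egalitarian_cost_return coord_median_midpoint ennreal_leI)
qed

lemma robust_median: "robust 2 median_mechanism"
  unfolding robust_def
proof (intro allI)
  fix x xh :: "2 profile"
  let ?y = "coord_median (x 1) (x 2) (midpoint (xh 1) (xh 2))"
  have "dist (x 1) ?y \<le> dist (x 1) (x 2)" "dist (x 2) ?y \<le> dist (x 1) (x 2)"
    using dist_coord_median_le coord_median_commute dist_commute by metis+
  then have "max_dist x ?y \<le> 2 * opt_cost x"
    using dist_le_twice_opt_cost[of x 1 2] by (simp add: max_dist_le_iff forall_2)
  then show "egalitarian_cost (median_mechanism x xh) x \<le> ennreal (2 * opt_cost x)"
    by (simp add: median_mechanism_def egalitarian_cost_return ennreal_leI)
qed

theorem theorem5:
  assumes "2 \<le> CARD('n::finite)"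
  shows "(\<forall>\<delta>::real. \<delta> > 0 \<longrightarrow>
            \<not> (\<exists>f :: 'n mechanism. randomized_mechanism f \<and> truthful_in_expectation f \<and>
                  consistent 1 f \<and> robust (2 - \<delta>) f)) \<and>
         (\<exists>f :: 2 mechanism. randomized_mechanism f \<and> truthful_in_expectation f \<and>
                  consistent 1 f \<and> robust 2 f)"
  using not_robust_of_truthful_consistent[OF assms] randomized_mechanism_median truthful_median
    consistent_median robust_median by blast

end
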